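(* Let $\lambda\supseteq\mu$ be partitions. (a) If $\mu=\emptyset$, then $\mathrm{rank}(\lambda)=\mathrm{zrank}(\lambda)$. (b) Let $n\ge\ell(\lambda)$. If every row of the matrix $\mathrm{JT}_{\lambda/\mu}=\left(h_{\lambda_i-\mu_j-i+j}\right)_{i,j=1}^n$ that contains an entry equal to $0$ also contains an entry equal to $1$, then $\mathrm{rank}(\lambda/\mu)=\mathrm{zrank}(\lambda/\mu)$.
   Context: The skew diagram is $\lambda/\mu=\{(i,j):\mu_i<j\le\lambda_i\}$. An outside top corner is a square $(i,j)\in\lambda/\mu$ with $(i-1,j),(i,j-1)\notin\lambda/\mu$; an inside top corner is $(i,j)\in\lambda/\mu$ with $(i-1,j),(i,j-1)\in\lambda/\mu$, $(i-1,j-1)\notin\lambda/\mu$. The diagonal of such a corner consists of all $(i+p,j+p)\in\lambda/\mu$, $p\ge0$. $\mathrm{rank}(\lambda/\mu)$ is the total number of squares on outside diagonals minus the total number on inside diagonals (for $\mu=\emptyset$ it is the length of the main diagonal of $\lambda$). $h_k$ is the complete homogeneous symmetric function of degree $k$, with $h_0=1$ and $h_k=0$ for $k<0$. $s_{\lambda/\mu}(1^t)$ is the skew Schur function at $x_1=\cdots=x_t=1$, $x_i=0$ for $i>t$, a polynomial in $t$; $\mathrm{zrank}(\lambda/\mu)$ is the largest $m$ with $t^m$ dividing it. *)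

theory Defs
  imports
    "HOL-Library.Multiset"
    "HOL-Library.FuncSet"
    "HOL-Computational_Algebra.Polynomial"
begin

text \<open>
  A partition is the list of its positive parts, so the empty partition is \<open>[]\<close> and
  \<open>\<ell>(\<lambda>)\<close> is \<open>length\<close>. All row, column and matrix indices are 1-based.
\<close>

definition is_partition :: "nat list \<Rightarrow> bool" where
  "is_partition lam \<longleftrightarrow> sorted_wrt (\<ge>) lam \<and> 0 \<notin> set lam"

definition part :: "nat list \<Rightarrow> nat \<Rightarrow> nat" where
  "part lam i = (if 1 \<le> i \<and> i \<le> length lam then lam ! (i - 1) else 0)"

definition partition_contains :: "nat list \<Rightarrow> nat list \<Rightarrow> bool" where
  "partition_contains lam mu \<longleftrightarrow> (\<forall>i. part mu i \<le> part lam i)"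

definition skew_diagram :: "nat list \<Rightarrow> nat list \<Rightarrow> (nat \<times> nat) set" where
  "skew_diagram lam mu = {(i, j). 1 \<le> i \<and> part mu i < j \<and> j \<le> part lam i}"

text \<open>
  Squares have positive coordinates, so the truncated subtractions below are harmless:
  they are only applied to squares of the diagram, and row 0 and column 0 are never in it.
\<close>

definition outside_top_corners :: "nat list \<Rightarrow> nat list \<Rightarrow> (nat \<times> nat) set" where
  "outside_top_corners lam mu =
     {(i, j) \<in> skew_diagram lam mu.
        (i - 1, j) \<notin> skew_diagram lam mu \<and> (i, j - 1) \<notin> skew_diagram lam mu}"

definition inside_top_corners :: "nat list \<Rightarrow> nat list \<Rightarrow> (nat \<times> nat) set" where
  "inside_top_corners lam mu =
     {(i, j) \<in> skew_diagram lam mu.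
        (i - 1, j) \<in> skew_diagram lam mu \<and> (i, j - 1) \<in> skew_diagram lam mu \<and>
        (i - 1, j - 1) \<notin> skew_diagram lam mu}"

definition corner_diagonal :: "nat list \<Rightarrow> nat list \<Rightarrow> nat \<times> nat \<Rightarrow> (nat \<times> nat) set" where
  "corner_diagonal lam mu c =
     {(fst c + p, snd c + p) | p. (fst c + p, snd c + p) \<in> skew_diagram lam mu}"

definition skew_rank :: "nat list \<Rightarrow> nat list \<Rightarrow> int" where
  "skew_rank lam mu =
     int (card (\<Union>c\<in>outside_top_corners lam mu. corner_diagonal lam mu c)) -
     int (card (\<Union>c\<in>inside_top_corners lam mu. corner_diagonal lam mu c))"

text \<open>
  Formal power series in \<open>x\<^sub>1, x\<^sub>2, \<dots>\<close> with integer coefficients are given by their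
  coefficient functions. The monomial \<open>x\<^sub>a x\<^sub>b \<cdots> x\<^sub>c\<close> is encoded as the multiset
  \<open>{#a, b, \<dots>, c#}\<close> of its variable indices, so \<open>size\<close> is its degree and \<open>{#}\<close> is the
  constant monomial. There is no variable \<open>x\<^sub>0\<close>.
\<close>

type_synonym sym_series = "nat multiset \<Rightarrow> int"

definition series_zero :: sym_series where
  "series_zero = (\<lambda>M. 0)"

definition series_one :: sym_series where
  "series_one = (\<lambda>M. if M = {#} then 1 else 0)"

definition complete_homogeneous :: "int \<Rightarrow> sym_series" where
  "complete_homogeneous k = (\<lambda>M. if 0 \<notin># M \<and> int (size M) = k then 1 else 0)"

definition jacobi_trudi_entry :: "nat list \<Rightarrow> nat list \<Rightarrow> nat \<Rightarrow> nat \<Rightarrow> sym_series" where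
  "jacobi_trudi_entry lam mu i j =
     complete_homogeneous (int (part lam i) - int (part mu j) - int i + int j)"

text \<open>
  Semistandard tableaux are extensional functions on the diagram (\<open>undefined\<close> outside it),
  so that distinct elements of the set below are distinct fillings.
\<close>

definition ssyt :: "nat list \<Rightarrow> nat list \<Rightarrow> (nat \<times> nat \<Rightarrow> nat) set" where
  "ssyt lam mu =
     {T \<in> skew_diagram lam mu \<rightarrow>\<^sub>E {1..}.
        (\<forall>i j j'. (i, j) \<in> skew_diagram lam mu \<and> (i, j') \<in> skew_diagram lam mu \<and> j < j'
            \<longrightarrow> T (i, j) \<le> T (i, j')) \<and>
        (\<forall>i i' j. (i, j) \<in> skew_diagram lam mu \<and> (i', j) \<in> skew_diagram lam mu \<and> i < i'
            \<longrightarrow> T (i, j) < T (i', j))}"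

definition skew_schur :: "nat list \<Rightarrow> nat list \<Rightarrow> sym_series" where
  "skew_schur lam mu =
     (\<lambda>M. int (card {T \<in> ssyt lam mu. image_mset T (mset_set (skew_diagram lam mu)) = M}))"

text \<open>
  The value at \<open>x\<^sub>1 = \<dots> = x\<^sub>t = 1\<close>, \<open>x\<^sub>i = 0\<close> for \<open>i > t\<close>. The sum is finite for every series of
  bounded degree, in particular for skew Schur functions.
\<close>

definition eval_ones :: "sym_series \<Rightarrow> nat \<Rightarrow> int" where
  "eval_ones f t = (\<Sum>M | set_mset M \<subseteq> {1..t} \<and> f M \<noteq> 0. f M)"

definition schur_poly :: "nat list \<Rightarrow> nat list \<Rightarrow> rat poly" where
  "schur_poly lam mu =
     (THE P. \<forall>t::nat. poly P (of_nat t) = of_int (eval_ones (skew_schur lam mu) t))"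

definition zrank :: "nat list \<Rightarrow> nat list \<Rightarrow> nat" where
  "zrank lam mu = (GREATEST m. [:0, 1:] ^ m dvd schur_poly lam mu)"

end

theory Submission
  imports Defs "Jordan_Normal_Form.Determinant"
begin

text \<open>
  Put \<open>a\<^sub>i = \<lambda>\<^sub>i - i\<close> and \<open>b\<^sub>j = \<mu>\<^sub>j - j\<close>. A square of content \<open>c\<close> lies on an outside diagonal iff
  \<open>c - 1\<close> is one of the \<open>b\<^sub>j\<close> and \<open>c\<close> is not, and on an inside diagonal iff the converse holds. Hence the
  rank telescopes along the rows of the diagram to the number of \<open>i\<close> such that \<open>a\<^sub>i\<close> is none of the
  \<open>b\<^sub>j\<close>, that is, to the number of rows of the Jacobi-Trudi matrix without an entry 1.

  Since \<open>h\<^sub>k(1\<^sup>t) = t(t+1)\<cdots>(t+k-1)/k!\<close> is divisible by \<open>t\<close> for \<open>k > 0\<close>, and by hypothesis the rows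
  without an entry 1 have no entry 0, one factor \<open>t\<close> splits off from each of these rows. At \<open>t = 0\<close>
  what remains is a matrix whose rows are unit vectors or rows of the Cauchy matrix
  \<open>1/(a\<^sub>i - b\<^sub>j)\<close>, and it is invertible. For \<open>\<mu> = \<emptyset>\<close> the hypothesis holds automatically.

  The Jacobi-Trudi identity at \<open>1\<^sup>t\<close> follows by induction on \<open>t\<close>: subtracting from each row the next
  one and expanding gives the same recursion as removing the entries \<open>t + 1\<close> from the tableaux.
\<close>

subsection \<open>The rank\<close>

text \<open>The content of the end of row i, so the contents in row i of the skew diagram fill
  \<open>{beta mu i<..beta lam i}\<close>. Rows beyond the length count too: there the value is
  -i.\<close>

definition beta :: "nat list \<Rightarrow> nat \<Rightarrow> int" where
  "beta lam i = int (part lam i) - int i"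

lemma part_antimono:
  assumes "is_partition lam" "1 \<le> i" "i \<le> j"
  shows "part lam j \<le> part lam i"
proof (cases "i = j \<or> length lam < j")
  case False
  then have "lam ! (j - 1) \<le> lam ! (i - 1)"
    using assms sorted_wrt_nth_less[of "(\<ge>)" lam "i - 1" "j - 1"]
    by (auto simp: is_partition_def)
  then show ?thesis
    using False assms by (auto simp: part_def)
qed (auto simp: part_def)

lemma beta_strict_antimono:
  assumes "is_partition lam" "1 \<le> i" "i < j"
  shows "beta lam j < beta lam i"
  using part_antimono[of lam i j] assms by (simp add: beta_def)

lemma beta_less_iff:
  assumes "is_partition lam" "1 \<le> i" "1 \<le> j"
  shows "beta lam j < beta lam i \<longleftrightarrow> i < j"
  using beta_strict_antimono[of lam i j] beta_strict_antimono[of lam j i] assms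
  by (metis less_asym' less_irrefl nat_neq_iff)

lemma beta_le_iff:
  assumes "is_partition lam" "1 \<le> i" "1 \<le> j"
  shows "beta lam j \<le> beta lam i \<longleftrightarrow> i \<le> j"
  using beta_less_iff[of lam j i] assms by (metis linorder_not_le)

lemma beta_mono:
  assumes "partition_contains lam mu"
  shows "beta mu i \<le> beta lam i"
  using assms by (simp add: beta_def partition_contains_def)

lemma mem_skew_diagram_iff:
  "(i, j) \<in> skew_diagram lam mu \<longleftrightarrow>
     1 \<le> i \<and> beta mu i < int j - int i \<and> int j - int i \<le> beta lam i"
  by (auto simp: skew_diagram_def beta_def)

text \<open>An outside corner starts its row i, so its content is \<open>beta mu i + 1\<close>, and
  the missing upper neighbour keeps that content out of the values of \<open>beta mu\<close>.
  Conversely, if c - 1 is \<open>beta mu k\<close>, the diagonal of content c, followed up to row k,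
  meets the first square there.\<close>

lemma outside_diagonals:
  assumes "is_partition lam" "is_partition mu"
  shows "(\<Union>c\<in>outside_top_corners lam mu. corner_diagonal lam mu c) =
    {(i, j) \<in> skew_diagram lam mu.
       int j - int i - 1 \<in> beta mu ` {1..} \<and> int j - int i \<notin> beta mu ` {1..}}" (is "?L = ?R")
proof (intro equalityI subsetI)
  fix z assume "z \<in> ?L"
  then obtain i j p where c: "(i, j) \<in> outside_top_corners lam mu"
    and z: "z = (i + p, j + p)" "z \<in> skew_diagram lam mu"
    by (fastforce simp: corner_diagonal_def)
  have ij: "1 \<le> i" "part mu i < j" "j \<le> part lam i"
    and up: "(i - 1, j) \<notin> skew_diagram lam mu" and left: "(i, j - 1) \<notin> skew_diagram lam mu"
    using c by (auto simp: outside_top_corners_def skew_diagram_def)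
  have "int j - int i - 1 = beta mu i"
    using ij left by (auto simp: skew_diagram_def beta_def)
  moreover have "int j - int i \<notin> beta mu ` {1..}"
  proof
    assume "int j - int i \<in> beta mu ` {1..}"
    then obtain k where k: "1 \<le> k" "int j - int i = beta mu k"
      by auto
    then have "beta mu i < beta mu k"
      using ij by (simp add: beta_def)
    then have "k < i"
      using beta_less_iff[of mu k i] assms k ij by simp
    then have "beta mu (i - 1) \<le> beta mu k"
      using beta_le_iff[of mu k "i - 1"] assms k by simp
    \<comment> \<open>Row i - 1 of \<lambda> reaches column j, so the upper neighbour can only be
      missing because it lies in \<mu>.\<close>
    moreover have "j \<le> part mu (i - 1)"
    proof -
      have "1 \<le> i - 1"
        using \<open>k < i\<close> k by simp
      then show ?thesis
        using up ij part_antimono[of lam "i - 1" i] assms by (auto simp: skew_diagram_def)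
    qed
    ultimately show False
      using k \<open>k < i\<close> by (simp add: beta_def)
  qed
  ultimately show "z \<in> ?R"
    using z ij by (auto simp: image_iff)
next
  fix z assume "z \<in> ?R"
  then obtain x y k where z: "z = (x, y)" "(x, y) \<in> skew_diagram lam mu"
    and k: "1 \<le> k" "int y - int x - 1 = beta mu k" and nb: "int y - int x \<notin> beta mu ` {1..}"
    by auto
  have x: "1 \<le> x" "beta mu x < int y - int x" "int y - int x \<le> beta lam x"
    using z by (simp_all add: mem_skew_diagram_iff)
  then have "k \<le> x"
    using beta_le_iff[of mu k x] assms k by simp
  then have "beta lam x \<le> beta lam k"
    using beta_le_iff[of lam k x] assms k by simp
  then have corner: "(k, part mu k + 1) \<in> skew_diagram lam mu"
    using k x by (auto simp: mem_skew_diagram_iff beta_def)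
  moreover have "(k - 1, part mu k + 1) \<notin> skew_diagram lam mu"
  proof
    assume up: "(k - 1, part mu k + 1) \<in> skew_diagram lam mu"
    then have "part mu (k - 1) = part mu k" "1 \<le> k - 1"
      using part_antimono[of mu "k - 1" k] assms by (auto simp: skew_diagram_def)
    then have "int y - int x = beta mu (k - 1)"
      using k by (simp add: beta_def)
    then show False
      using nb \<open>1 \<le> k - 1\<close> by (metis atLeast_iff image_eqI)
  qed
  ultimately have "(k, part mu k + 1) \<in> outside_top_corners lam mu"
    by (simp add: outside_top_corners_def skew_diagram_def)
  moreover have "(x, y) = (k + (x - k), part mu k + 1 + (x - k))"
    using k \<open>k \<le> x\<close> by (simp add: beta_def)
  then have "(x, y) \<in> corner_diagonal lam mu (k, part mu k + 1)"
    using z unfolding corner_diagonal_def by force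
  ultimately show "z \<in> ?L"
    using z by blast
qed

text \<open>An inside corner in row i sits diagonally below the end of row i - 1 of \<mu>, so its
  content is \<open>beta mu (i - 1)\<close>. Its left neighbour in the diagram amounts to a gap of
  at least 2 between this value and the next one, \<open>beta mu i\<close>.\<close>

lemma inside_diagonals:
  assumes "is_partition lam" "is_partition mu"
  shows "(\<Union>c\<in>inside_top_corners lam mu. corner_diagonal lam mu c) =
    {(i, j) \<in> skew_diagram lam mu.
       int j - int i \<in> beta mu ` {1..} \<and> int j - int i - 1 \<notin> beta mu ` {1..}}" (is "?L = ?R")
proof (intro equalityI subsetI)
  fix z assume "z \<in> ?L"
  then obtain i j p where c: "(i, j) \<in> inside_top_corners lam mu"
    and z: "z = (i + p, j + p)" "z \<in> skew_diagram lam mu"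
    by (fastforce simp: corner_diagonal_def)
  have up: "1 \<le> i - 1" "part mu (i - 1) < j" "j \<le> part lam (i - 1)"
    and left: "part mu i < j - 1"
    and diag: "(i - 1, j - 1) \<notin> skew_diagram lam mu"
    using c by (auto simp: inside_top_corners_def skew_diagram_def)
  have b: "int j - int i = beta mu (i - 1)"
    using up diag by (auto simp: skew_diagram_def beta_def)
  moreover have "int j - int i - 1 \<notin> beta mu ` {1..}"
  proof
    assume "int j - int i - 1 \<in> beta mu ` {1..}"
    then obtain k where k: "1 \<le> k" "int j - int i - 1 = beta mu k"
      by auto
    then have "beta mu i < beta mu k" "beta mu k < beta mu (i - 1)"
      using left b by (simp_all add: beta_def)
    then have "k < i" "i - 1 < k"
      using beta_less_iff[of mu k i] beta_less_iff[of mu "i - 1" k] assms k up by simp_all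
    then show False
      by simp
  qed
  ultimately show "z \<in> ?R"
    using z up by (auto simp: image_iff)
next
  fix z assume "z \<in> ?R"
  then obtain x y k where z: "z = (x, y)" "(x, y) \<in> skew_diagram lam mu"
    and k: "1 \<le> k" "int y - int x = beta mu k" and nb: "int y - int x - 1 \<notin> beta mu ` {1..}"
    by auto
  have x: "1 \<le> x" "beta mu x < int y - int x" "int y - int x \<le> beta lam x"
    using z by (simp_all add: mem_skew_diagram_iff)
  then have "k < x"
    using beta_less_iff[of mu k x] assms k by simp
  then have "beta lam x \<le> beta lam (k + 1)" "beta lam (k + 1) < beta lam k"
    using beta_le_iff[of lam "k + 1" x] beta_less_iff[of lam k "k + 1"] assms k by simp_all
  moreover have "beta mu (k + 1) < beta mu k"
    using beta_less_iff[of mu k "k + 1"] assms k by simp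
  \<comment> \<open>With the strict decrease this is a drop of at least 2, which puts the left
    neighbour \<open>(k + 1, part mu k)\<close> into the diagram.\<close>
  moreover have "beta mu (k + 1) \<noteq> beta mu k - 1"
    using nb k by (metis atLeast_iff image_eqI le_add2)
  ultimately have "(k + 1, part mu k + 1) \<in> inside_top_corners lam mu"
    using k x by (auto simp: inside_top_corners_def mem_skew_diagram_iff beta_def)
  moreover have "(x, y) = (k + 1 + (x - k - 1), part mu k + 1 + (x - k - 1))"
    using k \<open>k < x\<close> by (simp add: beta_def)
  then have "(x, y) \<in> corner_diagonal lam mu (k + 1, part mu k + 1)"
    using z unfolding corner_diagonal_def by force
  ultimately show "z \<in> ?L"
    using z by blast
qed

lemma sum_telescope_int:
  fixes f :: "int \<Rightarrow> int"
  assumes "a \<le> b"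
  shows "(\<Sum>c\<in>{a<..b}. f (c - 1) - f c) = f a - f b"
  using assms
proof (induction rule: int_ge_induct)
  case (step b)
  then have "{a<..b + 1} = insert (b + 1) {a<..b}"
    by auto
  then show ?case
    using step by simp
qed simp

lemma skew_diagram_eq_Sigma:
  assumes "length lam \<le> n"
  shows "skew_diagram lam mu = Sigma {1..n} (\<lambda>i. {part mu i<..part lam i})"
  using assms by (auto simp: skew_diagram_def part_def split: if_splits)

lemma finite_skew_diagram: "finite (skew_diagram lam mu)"
  unfolding skew_diagram_eq_Sigma[OF order_refl] by blast

lemma skew_rank_eq:
  assumes lam: "is_partition lam" and mu: "is_partition mu" and sub: "partition_contains lam mu"
    and n: "length lam \<le> n"
  shows "skew_rank lam mu = int (card {i\<in>{1..n}. \<forall>j\<in>{1..n}. beta lam i \<noteq> beta mu j})"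
proof -
  let ?B = "beta mu ` {1..}" and ?D = "skew_diagram lam mu"
  \<comment> \<open>A square of content c contributes g (c - 1) - g c to outside minus inside
    diagonals.\<close>
  define g where "g c = (if c \<in> ?B then 1 else 0 :: int)" for c
  have row: "(\<Sum>j\<in>{part mu i<..part lam i}. g (int j - int i - 1) - g (int j - int i)) =
      g (beta mu i) - g (beta lam i)" for i
  proof -
    have "(\<Sum>j\<in>{part mu i<..part lam i}. g (int j - int i - 1) - g (int j - int i)) =
        (\<Sum>c\<in>{beta mu i<..beta lam i}. g (c - 1) - g c)"
      by (rule sum.reindex_bij_witness[of _ "\<lambda>c. nat (c + int i)" "\<lambda>j. int j - int i"])
        (auto simp: beta_def)
    then show ?thesis
      using sum_telescope_int[OF beta_mono[OF sub], of g i] by simp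
  qed
  have "skew_rank lam mu =
      (\<Sum>(i, j)\<in>?D. if int j - int i - 1 \<in> ?B \<and> int j - int i \<notin> ?B then 1 else 0) -
      (\<Sum>(i, j)\<in>?D. if int j - int i \<in> ?B \<and> int j - int i - 1 \<notin> ?B then 1 else 0)"
    unfolding skew_rank_def outside_diagonals[OF lam mu] inside_diagonals[OF lam mu]
    using finite_skew_diagram[of lam mu]
    by (simp add: case_prod_unfold sum.If_cases Int_def)
  also have "\<dots> = (\<Sum>(i, j)\<in>?D. g (int j - int i - 1) - g (int j - int i))"
    unfolding sum_subtractf[symmetric] by (rule sum.cong) (auto simp: g_def)
  also have "\<dots> = (\<Sum>i\<in>{1..n}. g (beta mu i) - g (beta lam i))"
    unfolding skew_diagram_eq_Sigma[OF n] by (subst sum.Sigma[symmetric]) (simp_all add: row)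
  also have "\<dots> = (\<Sum>i\<in>{1..n}. if \<forall>j\<in>{1..n}. beta lam i \<noteq> beta mu j then 1 else 0)"
  proof (rule sum.cong)
    fix i assume i: "i \<in> {1..n}"
    \<comment> \<open>For j > n both parts are 0, and -j is less than \<open>beta lam i\<close>. So
      the first n columns detect every match.\<close>
    have "j \<le> n" if "beta lam i = beta mu j" for j
    proof (rule ccontr)
      assume "\<not> j \<le> n"
      have "part lam j = 0"
        using \<open>\<not> j \<le> n\<close> n by (simp add: part_def)
      moreover have "part mu j \<le> part lam j"
        using sub by (simp add: partition_contains_def)
      ultimately show False
        using that i \<open>\<not> j \<le> n\<close> by (simp add: beta_def)
    qed
    then have "beta lam i \<in> ?B \<longleftrightarrow> (\<exists>j\<in>{1..n}. beta lam i = beta mu j)"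
      by fastforce
    then show "g (beta mu i) - g (beta lam i) =
        (if \<forall>j\<in>{1..n}. beta lam i \<noteq> beta mu j then 1 else 0)"
      using i by (auto simp: g_def)
  qed simp
  also have "\<dots> = int (card {i\<in>{1..n}. \<forall>j\<in>{1..n}. beta lam i \<noteq> beta mu j})"
    by (simp add: sum.If_cases Int_def)
  finally show ?thesis .
qed

subsection \<open>Counting tableaux\<close>

text \<open>Squares are indexed from 1, but the rows of \<open>l\<close> and \<open>m\<close> from 0, as in the matrices below.\<close>

definition shape :: "nat \<Rightarrow> (nat \<Rightarrow> nat) \<Rightarrow> (nat \<Rightarrow> nat) \<Rightarrow> (nat \<times> nat) set" where
  "shape n l m = {(Suc i, j) | i j. i < n \<and> m i < j \<and> j \<le> l i}"

lemma Suc_mem_shape [simp]: "(Suc i, j) \<in> shape n l m \<longleftrightarrow> i < n \<and> m i < j \<and> j \<le> l i"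
  by (simp add: shape_def)

lemma mem_shapeE:
  assumes "(i', j) \<in> shape n l m"
  obtains i where "i' = Suc i" "i < n" "m i < j" "j \<le> l i"
  using assms by (auto simp: shape_def)

lemma finite_shape: "finite (shape n l m)"
proof -
  have "shape n l m = (\<lambda>(i, j). (Suc i, j)) ` Sigma {..<n} (\<lambda>i. {m i<..l i})"
    by (auto simp: shape_def image_iff)
  then show ?thesis
    by simp
qed

text \<open>The set of squares is arbitrary, so that this serves both \<open>skew_diagram\<close>
  and \<open>shape\<close>.\<close>

definition tableaux :: "(nat \<times> nat) set \<Rightarrow> nat \<Rightarrow> (nat \<times> nat \<Rightarrow> nat) set" where
  "tableaux D t =
     {T \<in> D \<rightarrow>\<^sub>E {1..t}.
        (\<forall>i j j'. (i, j) \<in> D \<and> (i, j') \<in> D \<and> j < j' \<longrightarrow> T (i, j) \<le> T (i, j')) \<and>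
        (\<forall>i i' j. (i, j) \<in> D \<and> (i', j) \<in> D \<and> i < i' \<longrightarrow> T (i, j) < T (i', j))}"

lemma finite_tableaux: "finite D \<Longrightarrow> finite (tableaux D t)"
  by (rule finite_subset[of _ "D \<rightarrow>\<^sub>E {1..t}"]) (auto simp: tableaux_def intro: finite_PiE)

text \<open>The two conditions on \<open>D'\<close> say that \<open>D - D'\<close> is a horizontal strip at the right border.\<close>

lemma card_tableaux_fibre:
  assumes sub: "D' \<subseteq> D"
    and left: "\<And>i j j'. (i, j') \<in> D' \<Longrightarrow> (i, j) \<in> D \<Longrightarrow> j < j' \<Longrightarrow> (i, j) \<in> D'"
    and strip: "\<And>i i' j. (i, j) \<in> D \<Longrightarrow> (i', j) \<in> D \<Longrightarrow> i < i' \<Longrightarrow> (i, j) \<in> D'"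
  shows "card {T \<in> tableaux D (Suc t). {x \<in> D. T x \<le> t} = D'} = card (tableaux D' t)"
proof (rule bij_betw_same_card)
  let ?F = "{T \<in> tableaux D (Suc t). {x \<in> D. T x \<le> t} = D'}"
  \<comment> \<open>The inverse of restriction puts the largest entry t + 1 on all squares outside
    \<open>D'\<close>.\<close>
  let ?ext = "\<lambda>S. \<lambda>x\<in>D. if x \<in> D' then S x else Suc t"
  show "bij_betw (\<lambda>T. restrict T D') ?F (tableaux D' t)"
  proof (rule bij_betw_byWitness[where f' = ?ext])
    show "\<forall>T\<in>?F. ?ext (restrict T D') = T"
    proof
      fix T assume T: "T \<in> ?F"
      then have "T \<in> D \<rightarrow>\<^sub>E {1..Suc t}"
        by (simp add: tableaux_def)
      moreover have "T x = Suc t" if "x \<in> D" "x \<notin> D'" for x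
      proof -
        have "\<not> T x \<le> t"
          using T that by blast
        moreover have "T x \<le> Suc t"
          using PiE_mem[OF \<open>T \<in> D \<rightarrow>\<^sub>E {1..Suc t}\<close> \<open>x \<in> D\<close>] by simp
        ultimately show ?thesis
          by simp
      qed
      ultimately show "?ext (restrict T D') = T"
        by (auto simp: restrict_def fun_eq_iff PiE_def extensional_def)
    qed
    show "\<forall>S\<in>tableaux D' t. restrict (?ext S) D' = S"
      using sub by (auto simp: tableaux_def restrict_def fun_eq_iff PiE_def extensional_def)
    show "(\<lambda>T. restrict T D') ` ?F \<subseteq> tableaux D' t"
    proof (clarify)
      fix T assume T: "T \<in> tableaux D (Suc t)" and D': "D' = {x \<in> D. T x \<le> t}"
      have "1 \<le> T x" if "x \<in> D" for x
        using T that by (auto simp: tableaux_def)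
      then show "restrict T {x \<in> D. T x \<le> t} \<in> tableaux {x \<in> D. T x \<le> t} t"
        using T by (auto simp: tableaux_def)
    qed
    show "?ext ` tableaux D' t \<subseteq> ?F"
    proof (clarify)
      fix S assume S: "S \<in> tableaux D' t"
      have range: "S x \<in> {1..t}" if "x \<in> D'" for x
        using S that by (auto simp: tableaux_def)
      have "?ext S \<in> D \<rightarrow>\<^sub>E {1..Suc t}"
        using range by (auto simp: le_Suc_eq)
      moreover have "?ext S (i, j) \<le> ?ext S (i, j')" if "(i, j) \<in> D" "(i, j') \<in> D" "j < j'" for i j j'
        using that left[of i j' j] S range[of "(i, j)"] by (auto simp: tableaux_def le_Suc_eq)
      moreover have "?ext S (i, j) < ?ext S (i', j)" if "(i, j) \<in> D" "(i', j) \<in> D" "i < i'" for i i' j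
        using that strip[of i j i'] S range[of "(i, j)"] by (auto simp: tableaux_def)
      moreover have "{x \<in> D. ?ext S x \<le> t} = D'"
        using sub range by auto
      ultimately show "?ext S \<in> tableaux D (Suc t) \<and> {x \<in> D. ?ext S x \<le> t} = D'"
        unfolding tableaux_def by blast
    qed
  qed
qed

text \<open>Row \<open>i\<close> of a partition \<open>\<nu>\<close> with \<open>\<lambda>/\<nu>\<close> a horizontal strip ranges over this interval; only
  the lower bound of the last row refers to the inner partition \<open>m\<close>.\<close>

definition interlace :: "nat \<Rightarrow> (nat \<Rightarrow> nat) \<Rightarrow> (nat \<Rightarrow> nat) \<Rightarrow> nat \<Rightarrow> nat set" where
  "interlace n l m i = {(if Suc i < n then l (Suc i) else m i)..l i}"

text \<open>Tableaux are sorted by the region \<open>shape n \<nu> m\<close> of their entries up to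
  t; the entries t + 1 form a horizontal strip since columns increase strictly. Those \<nu> that do
  not contain m stay in the sum with value 0, so that it ranges over a full product, as the
  expansion of the determinant does.\<close>

lemma tableaux_step:
  assumes l: "\<And>i j. i \<le> j \<Longrightarrow> j < n \<Longrightarrow> l j \<le> l i"
    and m: "\<And>i j. i \<le> j \<Longrightarrow> j < n \<Longrightarrow> m j \<le> m i"
    and sub: "\<And>i. i < n \<Longrightarrow> m i \<le> l i"
  shows "card (tableaux (shape n l m) (Suc t)) =
    (\<Sum>\<nu>\<in>Pi\<^sub>E {0..<n} (interlace n l m).
       if \<forall>i<n. m i \<le> \<nu> i then card (tableaux (shape n \<nu> m) t) else 0)"
proof -
  let ?D = "shape n l m"
  let ?I = "{\<nu> \<in> Pi\<^sub>E {0..<n} (interlace n l m). \<forall>i<n. m i \<le> \<nu> i}"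
  let ?F = "\<lambda>\<nu>. {T \<in> tableaux ?D (Suc t). {x \<in> ?D. T x \<le> t} = shape n \<nu> m}"
  have fin: "finite (Pi\<^sub>E {0..<n} (interlace n l m))"
    by (intro finite_PiE) (auto simp: interlace_def)
  have inj: "\<nu> = \<nu>'" if "\<nu> \<in> ?I" "\<nu>' \<in> ?I" "shape n \<nu> m = shape n \<nu>' m" for \<nu> \<nu>'
  proof (rule PiE_ext[of \<nu> "{0..<n}" "interlace n l m" \<nu>'])
    fix i assume i: "i \<in> {0..<n}"
    have "(Suc i, j) \<in> shape n \<nu> m \<longleftrightarrow> (Suc i, j) \<in> shape n \<nu>' m" for j
      by (simp only: that(3))
    then have "m i < j \<and> j \<le> \<nu> i \<longleftrightarrow> m i < j \<and> j \<le> \<nu>' i" for j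
      using i by simp
    \<comment> \<open>The squares determine a row end only where it exceeds \<open>m i\<close>;
      otherwise both ends equal \<open>m i\<close>.\<close>
    from this[of "\<nu> i"] this[of "\<nu>' i"] have "m i < \<nu> i \<or> m i < \<nu>' i \<Longrightarrow> \<nu> i = \<nu>' i"
      by arith
    moreover have "m i \<le> \<nu> i" "m i \<le> \<nu>' i"
      using that i by simp_all
    ultimately show "\<nu> i = \<nu>' i"
      by arith
  next
    show "\<nu> \<in> Pi\<^sub>E {0..<n} (interlace n l m)" "\<nu>' \<in> Pi\<^sub>E {0..<n} (interlace n l m)"
      using that by blast+
  qed
  have cover: "\<exists>\<nu>\<in>?I. T \<in> ?F \<nu>" if T: "T \<in> tableaux ?D (Suc t)" for T
  proof -
    have row: "T (i, j) \<le> T (i, j')" if "(i, j) \<in> ?D" "(i, j') \<in> ?D" "j \<le> j'" for i j j'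
      using T that by (cases "j = j'") (auto simp: tableaux_def)
    have col: "T (i, j) < T (i', j)" if "(i, j) \<in> ?D" "(i', j) \<in> ?D" "i < i'" for i i' j
      using T that by (auto simp: tableaux_def)
    have ub: "T x \<le> Suc t" if "x \<in> ?D" for x
      using T that by (auto simp: tableaux_def)
    \<comment> \<open>Inserting \<open>m i\<close> makes the maximum meaningful in rows without
      entries up to t.\<close>
    define S where "S i = insert (m i) {j \<in> {m i<..l i}. T (Suc i, j) \<le> t}" for i
    define \<nu> where "\<nu> = (\<lambda>i\<in>{0..<n}. Max (S i))"
    have S: "finite (S i)" for i
      by (simp add: S_def)
    have nu_mem: "\<nu> i \<in> S i" if "i < n" for i
      using Max_in[OF S[of i]] that by (auto simp: \<nu>_def S_def)
    have small: "T (Suc i, j) \<le> t \<longleftrightarrow> j \<le> \<nu> i" if "i < n" "m i < j" "j \<le> l i" for i j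
    proof
      assume "T (Suc i, j) \<le> t"
      then have "j \<in> S i"
        using that by (simp add: S_def)
      then show "j \<le> \<nu> i"
        using that S by (simp add: \<nu>_def)
    next
      assume "j \<le> \<nu> i"
      then show "T (Suc i, j) \<le> t"
        using nu_mem[OF \<open>i < n\<close>] that row[of "Suc i" j "\<nu> i"] by (auto simp: S_def)
    qed
    have bounds: "m i \<le> \<nu> i" "\<nu> i \<le> l i" if "i < n" for i
      using nu_mem[OF that] sub[OF that] by (auto simp: S_def)
    \<comment> \<open>Otherwise the square in column \<open>l (Suc i)\<close> of this row holds t +
      1 and the one below it a larger entry.\<close>
    have "l (Suc i) \<le> \<nu> i" if "Suc i < n" for i
    proof (rule ccontr)
      let ?j = "l (Suc i)"
      assume *: "\<not> ?j \<le> \<nu> i"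
      have "m (Suc i) \<le> m i" "m i \<le> \<nu> i" "?j \<le> l i"
        using l[of i "Suc i"] m[of i "Suc i"] bounds[of i] that by simp_all
      then have D: "(Suc i, ?j) \<in> ?D" "(Suc (Suc i), ?j) \<in> ?D"
        using * that by simp_all
      then have "\<not> T (Suc i, ?j) \<le> t"
        using * small[of i ?j] by simp
      then show False
        using col[OF D] ub[OF D(2)] by simp
    qed
    then have "\<nu> \<in> ?I"
      using bounds by (auto simp: interlace_def \<nu>_def)
    moreover have "{x \<in> ?D. T x \<le> t} = shape n \<nu> m"
      using small bounds by (fastforce elim: mem_shapeE simp: shape_def)
    ultimately show ?thesis
      using T by blast
  qed
  have fibre: "card (?F \<nu>) = card (tableaux (shape n \<nu> m) t)" if \<nu>: "\<nu> \<in> ?I" for \<nu>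
  proof (rule card_tableaux_fibre)
    have bounds: "\<nu> i \<le> l i" "Suc i < n \<Longrightarrow> l (Suc i) \<le> \<nu> i" if "i < n" for i
    proof -
      have "\<nu> i \<in> interlace n l m i"
        using \<nu> that by auto
      then show "\<nu> i \<le> l i" "Suc i < n \<Longrightarrow> l (Suc i) \<le> \<nu> i"
        by (simp_all add: interlace_def)
    qed
    show "shape n \<nu> m \<subseteq> ?D"
      using bounds(1) by (fastforce simp: shape_def)
    show "(i, j) \<in> shape n \<nu> m" if "(i, j') \<in> shape n \<nu> m" "(i, j) \<in> ?D" "j < j'" for i j j'
      using that by (auto elim!: mem_shapeE)
    show "(i, j) \<in> shape n \<nu> m" if sq: "(i, j) \<in> ?D" "(i', j) \<in> ?D" "i < i'" for i i' j
    proof -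
      obtain a b where ab: "i = Suc a" "i' = Suc b" "b < n" "a < b" "m a < j" "j \<le> l b"
        using sq by (auto simp: shape_def)
      have "j \<le> \<nu> a"
        using ab l[of "Suc a" b] bounds(2)[of a] by simp
      then show ?thesis
        using ab by simp
    qed
  qed
  have "tableaux ?D (Suc t) = (\<Union>\<nu>\<in>?I. ?F \<nu>)"
  proof (intro equalityI subsetI)
    show "T \<in> (\<Union>\<nu>\<in>?I. ?F \<nu>)" if "T \<in> tableaux ?D (Suc t)" for T
      unfolding UN_iff using that by (rule cover)
    show "T \<in> tableaux ?D (Suc t)" if "T \<in> (\<Union>\<nu>\<in>?I. ?F \<nu>)" for T
      using that by (elim UN_E) simp
  qed
  then have "card (tableaux ?D (Suc t)) = card (\<Union>\<nu>\<in>?I. ?F \<nu>)"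
    by (rule arg_cong)
  also have "\<dots> = (\<Sum>\<nu>\<in>?I. card (?F \<nu>))"
  proof (intro card_UN_disjoint ballI impI)
    fix \<nu> \<nu>' assume *: "\<nu> \<in> ?I" "\<nu>' \<in> ?I" "\<nu> \<noteq> \<nu>'"
    then have "shape n \<nu> m \<noteq> shape n \<nu>' m"
      using inj[OF *(1,2)] by blast
    then show "?F \<nu> \<inter> ?F \<nu>' = {}"
      by blast
  qed (use fin finite_tableaux[OF finite_shape] in simp_all)
  also have "\<dots> = (\<Sum>\<nu>\<in>?I. card (tableaux (shape n \<nu> m) t))"
    by (intro sum.cong refl fibre)
  also have "\<dots> = (\<Sum>\<nu>\<in>Pi\<^sub>E {0..<n} (interlace n l m).
       if \<forall>i<n. m i \<le> \<nu> i then card (tableaux (shape n \<nu> m) t) else 0)"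
    using fin by (rule sum.inter_filter)
  finally show ?thesis .
qed

lemma card_tableaux_0:
  assumes "\<And>i. i < n \<Longrightarrow> m i \<le> l i"
  shows "card (tableaux (shape n l m) 0) = (if \<forall>i<n. l i = m i then 1 else 0)"
proof (cases "\<forall>i<n. l i = m i")
  case True
  then have "shape n l m = {}"
    by (auto simp: shape_def)
  then show ?thesis
    using True by (simp add: tableaux_def)
next
  case False
  then obtain i where "i < n" "l i \<noteq> m i"
    by blast
  then have mem: "(Suc i, l i) \<in> shape n l m"
    using assms[of i] by simp
  have "T \<notin> shape n l m \<rightarrow>\<^sub>E {1..0}" for T :: "nat \<times> nat \<Rightarrow> nat"
  proof
    assume "T \<in> shape n l m \<rightarrow>\<^sub>E {1..0}"
    from PiE_mem[OF this mem] show False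
      by simp
  qed
  then have "tableaux (shape n l m) 0 = {}"
    by (simp add: tableaux_def)
  then show ?thesis
    using False by simp
qed

subsection \<open>The Jacobi-Trudi identity\<close>

text \<open>The values \<open>h\<^sub>k(1\<^sup>t)\<close>, by recursion on the exponent of the last variable.\<close>

primrec hones :: "nat \<Rightarrow> int \<Rightarrow> int" where
  "hones 0 k = (if k = 0 then 1 else 0)"
| "hones (Suc t) k = (\<Sum>m\<in>{0..k}. hones t m)"

lemma hones_neg: "k < 0 \<Longrightarrow> hones t k = 0"
  by (cases t) simp_all

lemma hones_add_one: "hones (Suc t) (k + 1) = hones (Suc t) k + hones t (k + 1)"
proof (cases "0 \<le> k + 1")
  case True
  then have "{0..k + 1} = insert (k + 1) {0..k}"
    by auto
  then show ?thesis
    by simp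
qed (simp add: hones_neg)

text \<open>Telescoping of \<open>hones_add_one\<close>; the case p = q + 1 is the empty
  sum.\<close>

lemma hones_interval:
  assumes "p \<le> q + 1"
  shows "(\<Sum>x\<in>{p..q}. hones t (int x + s)) = hones (Suc t) (int q + s) - hones (Suc t) (int p - 1 + s)"
proof (cases "p \<le> q")
  case True
  then show ?thesis
  proof (induction rule: dec_induct)
    case base
    show ?case
      using hones_add_one[of t "int p - 1 + s"] by simp
  next
    case (step q)
    show ?case
      using step hones_add_one[of t "int q + s"] by (simp del: hones.simps add: algebra_simps)
  qed
next
  case False
  then have "p = q + 1"
    using assms by simp
  then show ?thesis
    by simp
qed

section \<open>Determinants with sums or differences in the rows\<close>

lemma det_mat:
  "det (mat n n (\<lambda>(i, j). f i j)) =
    (\<Sum>p | p permutes {0..<n}. signof p * (\<Prod>i=0..<n. f i (p i)))"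
  by (subst det_def'[of _ n]) (auto intro!: sum.cong prod.cong simp: permutes_in_image)

text \<open>Multilinearity in all rows at once: \<nu> chooses one summand from each row.\<close>

lemma det_sum_rows:
  assumes "\<And>i. i < n \<Longrightarrow> finite (S i)"
  shows "det (mat n n (\<lambda>(i, j). \<Sum>x\<in>S i. f i x j)) =
    (\<Sum>\<nu>\<in>Pi\<^sub>E {0..<n} S. det (mat n n (\<lambda>(i, j). f i (\<nu> i) j)))"
proof -
  have "(\<Prod>i=0..<n. \<Sum>x\<in>S i. f i x (p i)) = (\<Sum>\<nu>\<in>Pi\<^sub>E {0..<n} S. \<Prod>i=0..<n. f i (\<nu> i) (p i))" for p
    using assms by (intro prod_sum_PiE) simp_all
  then show ?thesis
    unfolding det_mat by (subst sum.swap) (simp add: sum_distrib_left)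
qed

text \<open>Subtracting from each row the next one is multiplication from the left by the
  unitriangular matrix \<open>U\<close>.\<close>

lemma det_row_differences:
  fixes f :: "nat \<Rightarrow> nat \<Rightarrow> 'a :: comm_ring_1"
  shows "det (mat n n (\<lambda>(i, j). f i j)) =
    det (mat n n (\<lambda>(i, j). f i j - (if Suc i < n then f (Suc i) j else 0)))"
proof -
  define U :: "'a mat" where
    "U = mat n n (\<lambda>(i, j). if j = i then 1 else if j = Suc i then - 1 else 0)"
  define A where "A = mat n n (\<lambda>(i, j). f i j)"
  have "det U = prod_list (diag_mat U)"
    by (rule det_upper_triangular[of _ n]) (auto simp: U_def)
  also have "diag_mat U = replicate n 1"
    by (auto simp: diag_mat_def U_def list_eq_iff_nth_eq)
  finally have "det U = 1"
    by simp
  moreover have "U * A = mat n n (\<lambda>(i, j). f i j - (if Suc i < n then f (Suc i) j else 0))"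
  proof (rule eq_matI)
    fix i j
    assume "i < dim_row (mat n n (\<lambda>(i, j). f i j - (if Suc i < n then f (Suc i) j else 0)))"
      and "j < dim_col (mat n n (\<lambda>(i, j). f i j - (if Suc i < n then f (Suc i) j else 0)))"
    then have ij: "i < n" "j < n"
      by simp_all
    have "(U * A) $$ (i, j) =
        (\<Sum>k\<in>{0..<n}. (if k = i then f k j else 0) - (if k = Suc i then f k j else 0))"
      using ij by (auto simp: U_def A_def scalar_prod_def intro!: sum.cong)
    then show "(U * A) $$ (i, j) =
        mat n n (\<lambda>(i, j). f i j - (if Suc i < n then f (Suc i) j else 0)) $$ (i, j)"
      using ij by (simp add: sum_subtractf)
  qed (simp_all add: U_def A_def)
  moreover have "det (U * A) = det U * det A"
    by (rule det_mult[of _ n]) (simp_all add: U_def A_def)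
  ultimately show ?thesis
    by (simp add: A_def)
qed

text \<open>After subtraction of the next row, an entry of row i telescopes to a sum over
  \<open>interlace n l m i\<close>: the shift from i to i + 1 turns \<open>l (Suc i)\<close> into
  \<open>l (Suc i) - 1\<close>, the point just below the interval.\<close>

lemma det_hones_step:
  assumes l: "\<And>i j. i \<le> j \<Longrightarrow> j < n \<Longrightarrow> l j \<le> l i"
    and m: "\<And>i j. i \<le> j \<Longrightarrow> j < n \<Longrightarrow> m j \<le> m i"
  shows "det (mat n n (\<lambda>(i, j). hones (Suc t) (int (l i) - int i - (int (m j) - int j)))) =
    (\<Sum>\<nu>\<in>Pi\<^sub>E {0..<n} (interlace n l m).
       det (mat n n (\<lambda>(i, j). hones t (int (\<nu> i) - int i - (int (m j) - int j)))))"
proof -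
  let ?h = "\<lambda>t i x j. hones t (int x - int i - (int (m j) - int j))"
  have "?h (Suc t) i (l i) j - (if Suc i < n then ?h (Suc t) (Suc i) (l (Suc i)) j else 0) =
      (\<Sum>x\<in>interlace n l m i. ?h t i x j)" if "i < n" "j < n" for i j
  proof (cases "Suc i < n")
    case True
    have "(\<Sum>x\<in>interlace n l m i. ?h t i x j) =
        (\<Sum>x\<in>{l (Suc i)..l i}. hones t (int x + (- int i - (int (m j) - int j))))"
      using True by (intro sum.cong arg_cong2[where f = hones]) (auto simp: interlace_def)
    also have "\<dots> = hones (Suc t) (int (l i) + (- int i - (int (m j) - int j))) -
        hones (Suc t) (int (l (Suc i)) - 1 + (- int i - (int (m j) - int j)))"
      using l[of i "Suc i"] True by (intro hones_interval) simp
    finally show ?thesis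
      using True by (simp del: hones.simps add: algebra_simps)
  next
    case False
    \<comment> \<open>In the last row nothing is subtracted, but the sum may start at
      \<open>m i\<close>, since the index at \<open>m i - 1\<close> is negative in every
      column.\<close>
    then have "m i \<le> m j" "j \<le> i"
      using m[of j i] that by simp_all
    then have neg: "int (m i) - int i - (int (m j) - int j) \<le> 0"
      by simp
    have sum: "(\<Sum>x\<in>interlace n l m i. ?h t i x j) =
        (\<Sum>x\<in>{m i..l i}. hones t (int x + (- int i - (int (m j) - int j))))"
      using False by (intro sum.cong arg_cong2[where f = hones]) (auto simp: interlace_def)
    show ?thesis
    proof (cases "m i \<le> l i + 1")
      case True
      have "hones (Suc t) (int (m i) - 1 + (- int i - (int (m j) - int j))) = 0"
        using neg by (intro hones_neg) simp
      then show ?thesis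
        using hones_interval[OF True, of t "- int i - (int (m j) - int j)"] False sum
        by (simp del: hones.simps add: algebra_simps)
    next
      case less: False
      then have "?h (Suc t) i (l i) j = 0"
        using neg by (intro hones_neg) simp
      then show ?thesis
        using less False sum by (simp del: hones.simps)
    qed
  qed
  then have "det (mat n n (\<lambda>(i, j). ?h (Suc t) i (l i) j)) =
      det (mat n n (\<lambda>(i, j). \<Sum>x\<in>interlace n l m i. ?h t i x j))"
    unfolding det_row_differences[of n "\<lambda>i. ?h (Suc t) i (l i)"]
    by (intro arg_cong[of _ _ det] cong_mat) (simp_all del: hones.simps)
  also have "\<dots> = (\<Sum>\<nu>\<in>Pi\<^sub>E {0..<n} (interlace n l m).
      det (mat n n (\<lambda>(i, j). ?h t i (\<nu> i) j)))"
    by (rule det_sum_rows) (simp add: interlace_def)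
  finally show ?thesis .
qed

lemma det_zero_row:
  fixes f :: "nat \<Rightarrow> nat \<Rightarrow> 'a :: comm_ring_1"
  assumes "i < n" "\<And>j. j < n \<Longrightarrow> f i j = 0"
  shows "det (mat n n (\<lambda>(i, j). f i j)) = 0"
proof -
  have "(\<Prod>k = 0..<n. mat n n (\<lambda>(i, j). f i j) $$ (k, p k)) = 0" if "p permutes {0..<n}" for p
    using that assms permutes_in_image[OF that, of i] by (intro prod_zero) (auto intro!: bexI[of _ i])
  then show ?thesis
    by (subst det_def'[of _ n]) simp_all
qed

lemma det_zero_column:
  fixes f :: "nat \<Rightarrow> nat \<Rightarrow> 'a :: comm_ring_1"
  assumes "j < n" "\<And>i. i < n \<Longrightarrow> f i j = 0"
  shows "det (mat n n (\<lambda>(i, j). f i j)) = 0"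
proof -
  have "transpose_mat (mat n n (\<lambda>(i, j). f i j)) = mat n n (\<lambda>(i, j). f j i)"
    by (rule eq_matI) simp_all
  then show ?thesis
    using det_transpose[of "mat n n (\<lambda>(i, j). f i j)" n] det_zero_row[of j n "\<lambda>i j. f j i"] assms
    by simp
qed

lemma det_hones_0:
  assumes l: "\<And>i j. i \<le> j \<Longrightarrow> j < n \<Longrightarrow> l j \<le> l i"
    and m: "\<And>i j. i \<le> j \<Longrightarrow> j < n \<Longrightarrow> m j \<le> m i"
  shows "det (mat n n (\<lambda>(i, j). hones 0 (int (l i) - int i - (int (m j) - int j)))) =
    (if \<forall>i<n. l i = m i then 1 else 0)"
proof (cases "\<forall>i<n. l i = m i")
  case True
  have "int (m i) - int i \<noteq> int (m j) - int j" if "i < n" "j < n" "i \<noteq> j" for i j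
    using m[of i j] m[of j i] that by linarith
  then have "mat n n (\<lambda>(i, j). hones 0 (int (l i) - int i - (int (m j) - int j))) = 1\<^sub>m n"
    using True by (intro eq_matI) auto
  then show ?thesis
    using True by simp
next
  case False
  define i where "i = (LEAST i. i < n \<and> l i \<noteq> m i)"
  have "i < n \<and> l i \<noteq> m i"
    unfolding i_def by (rule LeastI_ex) (use False in blast)
  then have i: "i < n" "l i \<noteq> m i"
    by simp_all
  have before: "l j = m j" if "j < i" for j
    using not_less_Least[of j "\<lambda>i. i < n \<and> l i \<noteq> m i"] that i by (auto simp: i_def)
  show ?thesis
  proof (cases "m i < l i")
    case True
    \<comment> \<open>For j < i the right side is larger, as l and m agree there; from i on it is
      smaller.\<close>
    have "int (l i) - int i \<noteq> int (m j) - int j" if "j < n" for j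
      using before[of j] l[of j i] m[of i j] i that True by (cases "j < i") auto
    then show ?thesis
      using i False by (subst det_zero_row[of i]) auto
  next
    case gt: False
    have "int (l j) - int j \<noteq> int (m i) - int i" if "j < n" for j
      using before[of j] m[of j i] l[of i j] i that gt by (cases "j < i") auto
    then show ?thesis
      using i False by (subst det_zero_column[of i]) auto
  qed
qed

text \<open>Both sides satisfy the same recursion in t. The case where l does not contain m is
  included because the induction passes through such \<nu>.\<close>

theorem jacobi_trudi_at_ones:
  assumes l: "\<And>i j. i \<le> j \<Longrightarrow> j < n \<Longrightarrow> l j \<le> l i"
    and m: "\<And>i j. i \<le> j \<Longrightarrow> j < n \<Longrightarrow> m j \<le> m i"
  shows "det (mat n n (\<lambda>(i, j). hones t (int (l i) - int i - (int (m j) - int j)))) =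
    (if \<forall>i<n. m i \<le> l i then int (card (tableaux (shape n l m) t)) else 0)"
  using l
proof (induction t arbitrary: l)
  case 0
  show ?case
    using det_hones_0[where l = l and m = m, OF 0 m] by (auto simp: card_tableaux_0)
next
  case (Suc t)
  have IH: "det (mat n n (\<lambda>(i, j). hones t (int (\<nu> i) - int i - (int (m j) - int j)))) =
      (if \<forall>i<n. m i \<le> \<nu> i then int (card (tableaux (shape n \<nu> m) t)) else 0)"
    if "\<nu> \<in> Pi\<^sub>E {0..<n} (interlace n l m)" for \<nu>
  proof (rule Suc.IH)
    fix i j assume "i \<le> j" "j < n"
    moreover have "\<nu> k \<in> interlace n l m k" if "k < n" for k
      using \<open>\<nu> \<in> Pi\<^sub>E {0..<n} (interlace n l m)\<close> that by auto
    \<comment> \<open>For i < j the chain is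
      \<open>\<nu> j \<le> l j \<le> l (Suc i) \<le> \<nu> i\<close>.\<close>
    from this[of i] this[of j] have "i < j \<Longrightarrow> l (Suc i) \<le> \<nu> i" "\<nu> j \<le> l j"
      using \<open>i \<le> j\<close> \<open>j < n\<close> by (auto simp: interlace_def split: if_splits)
    ultimately show "\<nu> j \<le> \<nu> i"
      using Suc.prems[of "Suc i" j] by (cases "i = j") auto
  qed
  have *: "det (mat n n (\<lambda>(i, j). hones (Suc t) (int (l i) - int i - (int (m j) - int j)))) =
      (\<Sum>\<nu>\<in>Pi\<^sub>E {0..<n} (interlace n l m).
         if \<forall>i<n. m i \<le> \<nu> i then int (card (tableaux (shape n \<nu> m) t)) else 0)"
    by (rule trans[OF det_hones_step[where l = l and m = m, OF Suc.prems m] sum.cong[OF refl IH]])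
  show ?case
  proof (cases "\<forall>i<n. m i \<le> l i")
    case True
    then have "int (card (tableaux (shape n l m) (Suc t))) =
        (\<Sum>\<nu>\<in>Pi\<^sub>E {0..<n} (interlace n l m).
           if \<forall>i<n. m i \<le> \<nu> i then int (card (tableaux (shape n \<nu> m) t)) else 0)"
      by (subst tableaux_step[where l = l and m = m, OF Suc.prems m]) (auto intro!: sum.cong)
    then show ?thesis
      using True * by simp
  next
    case False
    then obtain i where i: "i < n" "l i < m i"
      by (meson not_le)
    \<comment> \<open>Rows only shrink, so the failure at i persists and every summand is 0.\<close>
    have "\<not> (\<forall>i<n. m i \<le> \<nu> i)" if "\<nu> \<in> Pi\<^sub>E {0..<n} (interlace n l m)" for \<nu>
    proof -
      have "\<nu> i \<in> interlace n l m i"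
        using that i by auto
      then show ?thesis
        using i by (auto simp: interlace_def)
    qed
    then show ?thesis
      using False unfolding * by (subst sum.neutral) auto
  qed
qed

subsection \<open>The order of vanishing\<close>

text \<open>The polynomial in t with the values \<open>hones t k\<close>.\<close>

definition hpoly :: "int \<Rightarrow> rat poly" where
  "hpoly k = (if k < 0 then 0 else Polynomial.smult (1 / fact (nat k)) (pochhammer [:0, 1:] (nat k)))"

lemma poly_pochhammer: "poly (pochhammer p k) x = pochhammer (poly p x) k"
  by (induction k) (simp_all add: pochhammer_Suc)

lemma hones_0_right [simp]: "hones t 0 = 1"
  by (induction t) simp_all

text \<open>Both sides obey the recursion \<open>hones_add_one\<close>, which lowers either k or t;
  hence the nested induction.\<close>

lemma hones_eq_pochhammer: "of_int (hones t (int k)) = (pochhammer (of_nat t) k / fact k :: rat)"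
proof (induction t arbitrary: k)
  case 0
  show ?case
    by (cases k) (simp_all add: pochhammer_rec)
next
  case (Suc t)
  show ?case
  proof (induction k)
    case (Suc k)
    have "of_int (hones (Suc t) (int (Suc k))) =
        (of_int (hones (Suc t) (int k)) + of_int (hones t (int (Suc k))) :: rat)"
      using hones_add_one[of t "int k"] by (simp del: hones.simps add: add.commute)
    also have "\<dots> = pochhammer (of_nat (Suc t)) k / fact k +
        pochhammer (of_nat t) (Suc k) / fact (Suc k)"
      unfolding Suc.IH \<open>\<And>k. of_int (hones t (int k)) = _\<close> ..
    also have "pochhammer (of_nat t) (Suc k) = of_nat t * (pochhammer (of_nat (Suc t)) k :: rat)"
      by (simp add: pochhammer_rec add.commute)
    also have "pochhammer (of_nat (Suc t)) k / fact k +
        of_nat t * pochhammer (of_nat (Suc t)) k / fact (Suc k) =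
        (pochhammer (of_nat (Suc t)) (Suc k) / fact (Suc k) :: rat)"
      by (simp add: pochhammer_Suc divide_simps) (simp add: algebra_simps)
    finally show ?case .
  qed simp
qed

lemma poly_hpoly: "poly (hpoly k) (of_nat t) = of_int (hones t k)"
proof (cases "k < 0")
  case False
  then show ?thesis
    using hones_eq_pochhammer[of t "nat k"] by (simp add: hpoly_def poly_pochhammer)
qed (simp add: hpoly_def hones_neg)

text \<open>The rising factorial is t times the one starting at t + 1, which is (k - 1)! at t = 0.
  Division by k! leaves 1/k, the source of the Cauchy entries.\<close>

lemma hpoly_factor:
  assumes "0 < k"
  obtains q where "hpoly k = [:0, 1:] * q" "poly q 0 = 1 / of_int k"
proof
  define r where "r = nat k - 1"
  have k: "nat k = Suc r"
    using assms by (simp add: r_def)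
  let ?q = "Polynomial.smult (1 / fact (Suc r) :: rat) (pochhammer ([:0, 1:] + 1) r)"
  show "hpoly k = [:0, 1:] * ?q"
    using assms by (simp add: hpoly_def k pochhammer_rec del: fact_Suc)
  have "of_int k = (of_nat (Suc r) :: rat)"
    using assms k by (metis int_nat_eq of_int_of_nat_eq less_le_not_le)
  moreover have "poly ?q 0 = 1 / of_nat (Suc r)"
    by (simp add: poly_pochhammer pochhammer_fact[symmetric] del: of_nat_Suc)
  ultimately show "poly ?q 0 = 1 / of_int k"
    by simp
qed

section \<open>Determinants of polynomial matrices and their value at 0\<close>

lemma det_scale_rows:
  fixes c :: "nat \<Rightarrow> 'a :: comm_ring_1"
  shows "det (mat n n (\<lambda>(i, j). c i * f i j)) = (\<Prod>i=0..<n. c i) * det (mat n n (\<lambda>(i, j). f i j))"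
  unfolding det_mat by (simp add: prod.distrib sum_distrib_left mult_ac)

lemma poly_det:
  "poly (det (mat n n (\<lambda>(i, j). f i j))) x = det (mat n n (\<lambda>(i, j). poly (f i j) x))"
  unfolding det_mat poly_sum
  by (intro sum.cong refl) (auto simp: poly_prod sign_def)

lemma of_int_det:
  "(of_int (det (mat n n (\<lambda>(i, j). f i j))) :: 'a :: comm_ring_1) =
     det (mat n n (\<lambda>(i, j). of_int (f i j)))"
  unfolding det_mat by (auto simp: sign_def intro!: sum.cong)

text \<open>A kernel vector \<open>v\<close> gives the polynomial \<open>\<Sum>\<^sub>j v\<^sub>j \<Prod>\<^sub>k\<^sub>\<noteq>\<^sub>j (X - y\<^sub>k)\<close> of degree less than \<open>n\<close>, which
  vanishes at \<open>x\<^sub>1, \<dots>, x\<^sub>n\<close>; its value at \<open>y\<^sub>j\<close> is a nonzero multiple of \<open>v\<^sub>j\<close>.\<close>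

lemma det_cauchy_unit_rows:
  fixes x y :: "nat \<Rightarrow> 'a :: field"
  assumes x: "inj_on x {0..<n}" and y: "inj_on y {0..<n}"
  shows "det (mat n n (\<lambda>(i, j).
      if \<exists>k<n. x i = y k then (if x i = y j then 1 else 0) else 1 / (x i - y j))) \<noteq> 0"
    (is "det ?A \<noteq> 0")
proof
  assume "det ?A = 0"
  then obtain v where v: "v \<in> carrier_vec n" "v \<noteq> 0\<^sub>v n" "?A *\<^sub>v v = 0\<^sub>v n"
    using det_0_iff_vec_prod_zero[of ?A n] by auto
  have row: "(\<Sum>j\<in>{0..<n}. (if \<exists>k<n. x i = y k then (if x i = y j then 1 else 0)
      else 1 / (x i - y j)) * v $ j) = 0" if "i < n" for i
  proof -
    have "(?A *\<^sub>v v) $ i = 0"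
      using v(3) that by simp
    then show ?thesis
      using v(1) that by (simp add: scalar_prod_def cong: sum.cong_simp)
  qed
  define q where "q j = (\<Prod>k\<in>{0..<n} - {j}. [:- y k, 1:])" for j
  define p where "p = (\<Sum>j\<in>{0..<n}. Polynomial.smult (v $ j) (q j))"
  have q: "poly (q j) z = (\<Prod>k\<in>{0..<n} - {j}. z - y k)" for j z
    by (simp add: q_def poly_prod)
  have p_y: "poly p (y j) = v $ j * (\<Prod>k\<in>{0..<n} - {j}. y j - y k)" if "j < n" for j
  proof -
    have "poly p (y j) = (\<Sum>i\<in>{0..<n}. if i = j then v $ j * poly (q j) (y j) else 0)"
      unfolding p_def poly_sum
    proof (rule sum.cong)
      fix i assume i: "i \<in> {0..<n}"
      have "poly (q i) (y j) = 0" if "i \<noteq> j"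
        unfolding q using i that \<open>j < n\<close> by (intro prod_zero) auto
      then show "poly (Polynomial.smult (v $ i) (q i)) (y j) = (if i = j then v $ j * poly (q j) (y j) else 0)"
        by auto
    qed simp
    then show ?thesis
      using that by (simp add: q)
  qed
  have p_x: "poly p (x i) = 0" if i: "i < n" for i
  proof (cases "\<exists>k<n. x i = y k")
    case True
    then obtain k where k: "k < n" "x i = y k"
      by blast
    \<comment> \<open>A unit row of the matrix says that \<open>v $ k\<close> is 0, and this is a
      factor of the value of p at \<open>y k\<close>.\<close>
    have "y k = y j \<longleftrightarrow> j = k" if "j < n" for j
      using y k that by (auto simp: inj_on_eq_iff)
    then have "(\<Sum>j\<in>{0..<n}. if j = k then v $ j else 0) = 0"
      using row[OF i] True k by (auto simp: if_distrib[of "\<lambda>c. c * _"] cong: sum.cong_simp if_cong)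
    then show ?thesis
      using p_y[of k] k by simp
  next
    case False
    have "poly p (x i) = (\<Sum>j\<in>{0..<n}. (\<Prod>k\<in>{0..<n}. x i - y k) * (1 / (x i - y j) * v $ j))"
      unfolding p_def poly_sum
    proof (rule sum.cong)
      fix j assume j: "j \<in> {0..<n}"
      then have "(\<Prod>k\<in>{0..<n}. x i - y k) = (x i - y j) * (\<Prod>k\<in>{0..<n} - {j}. x i - y k)"
        by (intro prod.remove) simp_all
      then show "poly (Polynomial.smult (v $ j) (q j)) (x i) =
          (\<Prod>k\<in>{0..<n}. x i - y k) * (1 / (x i - y j) * v $ j)"
        using False j by (auto simp: q)
    qed simp
    also have "\<dots> = (\<Prod>k\<in>{0..<n}. x i - y k) * (\<Sum>j\<in>{0..<n}. 1 / (x i - y j) * v $ j)"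
      by (simp add: sum_distrib_left)
    also have "(\<Sum>j\<in>{0..<n}. 1 / (x i - y j) * v $ j) = 0"
      using row[OF i] False by simp
    finally show ?thesis
      by simp
  qed
  have "p = 0"
  proof (rule ccontr)
    assume "p \<noteq> 0"
    \<comment> \<open>For n = 0 the sum \<open>p\<close> is empty; this makes the truncated n - 1 a
      genuine bound.\<close>
    then have "0 < n"
      by (cases n) (auto simp: p_def)
    have "degree (q j) \<le> n - 1" if "j < n" for j
    proof -
      have "degree (q j) \<le> sum (degree \<circ> (\<lambda>k. [:- y k, 1:])) ({0..<n} - {j})"
        unfolding q_def by (rule degree_prod_sum_le) simp
      then show ?thesis
        using that by simp
    qed
    then have "degree p \<le> n - 1"
      unfolding p_def by (intro degree_sum_le) (auto intro: order.trans[OF degree_smult_le])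
    moreover have "x ` {0..<n} \<subseteq> {z. poly p z = 0}"
      using p_x by auto
    then have "card (x ` {0..<n}) \<le> card {z. poly p z = 0}"
      using poly_roots_finite[OF \<open>p \<noteq> 0\<close>] by (intro card_mono)
    then have "n \<le> degree p"
      using card_image[OF x] card_poly_roots_bound[OF \<open>p \<noteq> 0\<close>] by simp
    ultimately show False
      using \<open>0 < n\<close> by simp
  qed
  have "v $ j = 0" if "j < n" for j
  proof -
    have "(\<Prod>k\<in>{0..<n} - {j}. y j - y k) \<noteq> 0"
      using y that by (auto simp: prod_zero_iff inj_on_eq_iff)
    then show ?thesis
      using p_y[OF that] \<open>p = 0\<close> by simp
  qed
  then have "v = 0\<^sub>v n"
    using v(1) by (intro eq_vecI) auto
  then show False
    using v(2) by simp
qed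

text \<open>The assumption \<open>rows\<close> is the condition on the matrix: an entry is 0 iff
  \<open>a i < b j\<close>, and 1 iff \<open>a i = b j\<close>.\<close>

lemma det_hpoly_factor:
  fixes a b :: "nat \<Rightarrow> int"
  assumes a: "inj_on a {0..<n}" and b: "inj_on b {0..<n}"
    and rows: "\<And>i. i < n \<Longrightarrow> (\<exists>j<n. a i < b j) \<Longrightarrow> \<exists>j<n. a i = b j"
  obtains q where
    "det (mat n n (\<lambda>(i, j). hpoly (a i - b j))) = [:0, 1:] ^ card {i\<in>{0..<n}. \<forall>j<n. a i \<noteq> b j} * q"
    and "poly q 0 \<noteq> 0"
proof
  define R where "R = {i\<in>{0..<n}. \<forall>j<n. a i \<noteq> b j}"
  define g where "g k = (SOME q. hpoly k = [:0, 1:] * q \<and> poly q 0 = 1 / of_int k)" for k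
  have g: "hpoly k = [:0, 1:] * g k" "poly (g k) 0 = 1 / of_int k" if "0 < k" for k
  proof -
    have "\<exists>q. hpoly k = [:0, 1:] * q \<and> poly q 0 = 1 / of_int k"
      using hpoly_factor[OF that] by metis
    then show "hpoly k = [:0, 1:] * g k" "poly (g k) 0 = 1 / of_int k"
      unfolding g_def by (metis (mono_tags, lifting) someI_ex)+
  qed
  define c :: "nat \<Rightarrow> rat poly" where "c i = (if i \<in> R then [:0, 1:] else 1)" for i
  define f where "f i j = (if i \<in> R then g (a i - b j) else hpoly (a i - b j))" for i j
  \<comment> \<open>A row in \<open>R\<close> has no entry 1, hence by \<open>rows\<close> no entry
    0 either.\<close>
  have pos: "0 < a i - b j" if "i \<in> R" "j < n" for i j
    using that rows[of i] by (fastforce simp: R_def)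
  have "det (mat n n (\<lambda>(i, j). hpoly (a i - b j))) = det (mat n n (\<lambda>(i, j). c i * f i j))"
    using g(1) pos by (intro arg_cong[of _ _ det] cong_mat) (auto simp: c_def f_def)
  also have "\<dots> = (\<Prod>i=0..<n. c i) * det (mat n n (\<lambda>(i, j). f i j))"
    by (rule det_scale_rows)
  also have "(\<Prod>i=0..<n. c i) = [:0, 1:] ^ card R"
  proof -
    have "{0..<n} \<inter> R = R"
      by (auto simp: R_def)
    then show ?thesis
      by (simp add: c_def prod.If_cases)
  qed
  finally show "det (mat n n (\<lambda>(i, j). hpoly (a i - b j))) =
      [:0, 1:] ^ card {i\<in>{0..<n}. \<forall>j<n. a i \<noteq> b j} * det (mat n n (\<lambda>(i, j). f i j))"
    by (simp only: R_def)
  have hpoly_at_0: "poly (hpoly k) 0 = (if k = 0 then 1 else 0)" for k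
    using poly_hpoly[of k 0] by simp
  have inj: "inj_on (\<lambda>i. of_int (a i) :: rat) {0..<n}" "inj_on (\<lambda>j. of_int (b j) :: rat) {0..<n}"
    using a b by (simp_all only: inj_on_def of_int_eq_iff)
  \<comment> \<open>At t = 0 a row outside \<open>R\<close> becomes a unit row and a row in
    \<open>R\<close> a Cauchy row.\<close>
  have "poly (det (mat n n (\<lambda>(i, j). f i j))) 0 = det (mat n n (\<lambda>(i, j).
      if \<exists>k<n. of_int (a i) = (of_int (b k) :: rat)
      then (if of_int (a i) = (of_int (b j) :: rat) then 1 else 0)
      else 1 / (of_int (a i) - of_int (b j))))"
    unfolding poly_det using g(2) pos
    by (intro arg_cong[of _ _ det] cong_mat) (auto simp: f_def hpoly_at_0 R_def)
  then show "poly (det (mat n n (\<lambda>(i, j). f i j))) 0 \<noteq> 0"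
    using det_cauchy_unit_rows[OF inj] by (rule ssubst)
qed

section \<open>From the formal series to the zero at t = 0\<close>

text \<open>Killing the variables beyond t keeps the tableaux with entries up to t; putting the
  others to 1 forgets their weights.\<close>

lemma eval_ones_skew_schur:
  "eval_ones (skew_schur lam mu) t = int (card (tableaux (skew_diagram lam mu) t))"
proof -
  let ?D = "skew_diagram lam mu"
  define w where "w T = image_mset T (mset_set ?D)" for T :: "nat \<times> nat \<Rightarrow> nat"
  have set_w: "set_mset (w T) = T ` ?D" for T
    using finite_skew_diagram by (simp add: w_def)
  have ssyt_iff: "T \<in> ssyt lam mu \<and> T ` ?D \<subseteq> {1..t} \<longleftrightarrow> T \<in> tableaux ?D t" for T
    by (auto simp: ssyt_def tableaux_def PiE_def Pi_def)
  have fibre: "{T \<in> ssyt lam mu. w T = M} = {T \<in> tableaux ?D t. w T = M}"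
    if "set_mset M \<subseteq> {1..t}" for M
    using that ssyt_iff set_w by blast
  have fin: "finite (tableaux ?D t)"
    by (rule finite_tableaux[OF finite_skew_diagram])
  have "{M. set_mset M \<subseteq> {1..t} \<and> skew_schur lam mu M \<noteq> 0} = w ` tableaux ?D t"
  proof (intro equalityI subsetI)
    fix M assume M: "M \<in> {M. set_mset M \<subseteq> {1..t} \<and> skew_schur lam mu M \<noteq> 0}"
    then have "{T \<in> ssyt lam mu. w T = M} \<noteq> {}"
      unfolding skew_schur_def w_def by (metis (mono_tags, lifting) card.empty mem_Collect_eq of_nat_0)
    then show "M \<in> w ` tableaux ?D t"
      using M fibre by blast
  next
    fix M assume "M \<in> w ` tableaux ?D t"
    then obtain T where T: "T \<in> tableaux ?D t" "M = w T"
      by blast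
    then have M: "set_mset M \<subseteq> {1..t}"
      using iffD2[OF ssyt_iff T(1)] set_w by simp
    then have "card {T \<in> ssyt lam mu. w T = M} \<noteq> 0"
      using fin T by (auto simp: fibre)
    then show "M \<in> {M. set_mset M \<subseteq> {1..t} \<and> skew_schur lam mu M \<noteq> 0}"
      using M by (simp add: skew_schur_def w_def)
  qed
  then have "eval_ones (skew_schur lam mu) t = (\<Sum>M\<in>w ` tableaux ?D t. skew_schur lam mu M)"
    by (simp add: eval_ones_def)
  also have "\<dots> = (\<Sum>M\<in>w ` tableaux ?D t. \<Sum>T\<in>{T \<in> tableaux ?D t. w T = M}. 1)"
  proof (rule sum.cong)
    fix M assume "M \<in> w ` tableaux ?D t"
    then obtain T where T: "T \<in> tableaux ?D t" "M = w T"
      by blast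
    then have "set_mset M \<subseteq> {1..t}"
      using iffD2[OF ssyt_iff T(1)] set_w by simp
    then show "skew_schur lam mu M = (\<Sum>T\<in>{T \<in> tableaux ?D t. w T = M}. 1)"
      using fibre[of M] by (simp add: skew_schur_def w_def)
  qed simp
  also have "\<dots> = (\<Sum>T\<in>tableaux ?D t. 1)"
    using fin by (rule sum.image_gen[symmetric])
  finally show ?thesis
    by simp
qed

text \<open>Polynomials that agree at all natural numbers are equal.\<close>

lemma schur_poly_eqI:
  assumes "\<And>t. poly P (of_nat t) = of_int (eval_ones (skew_schur lam mu) t)"
  shows "schur_poly lam mu = P"
  unfolding schur_poly_def
proof (rule the_equality)
  show "\<forall>t. poly P (of_nat t) = of_int (eval_ones (skew_schur lam mu) t)"
    using assms by blast
  fix Q :: "rat poly"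
  assume Q: "\<forall>t::nat. poly Q (of_nat t) = of_int (eval_ones (skew_schur lam mu) t)"
  have "range (of_nat :: nat \<Rightarrow> rat) \<subseteq> {x. poly (Q - P) x = 0}"
    using assms Q by auto
  moreover have "infinite (range (of_nat :: nat \<Rightarrow> rat))"
    by (simp add: finite_image_iff inj_of_nat)
  ultimately have "infinite {x. poly (Q - P) x = 0}"
    using finite_subset by blast
  then have "Q - P = 0"
    using poly_roots_finite by blast
  then show "Q = P"
    by simp
qed

lemma zrank_eqI:
  assumes "schur_poly lam mu = [:0, 1:] ^ r * q" "poly q 0 \<noteq> 0"
  shows "zrank lam mu = r"
  unfolding zrank_def
proof (rule Greatest_equality)
  show "[:0, 1:] ^ r dvd schur_poly lam mu"
    using assms by simp
  fix m assume "[:0, 1:] ^ m dvd schur_poly lam mu"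
  show "m \<le> r"
  proof (rule ccontr)
    assume "\<not> m \<le> r"
    then have "[:0, 1:] ^ Suc r dvd [:0, 1:] ^ r * q"
      using \<open>[:0, 1:] ^ m dvd _\<close> assms by (metis not_less_eq_eq power_le_dvd)
    then have "[:0, 1:] dvd q"
      by (simp del: mult_pCons_left)
    then show False
      using assms(2) by auto
  qed
qed

lemma complete_homogeneous_eq_zero_iff: "complete_homogeneous k = series_zero \<longleftrightarrow> k < 0"
proof
  assume "complete_homogeneous k = series_zero"
  \<comment> \<open>For k \<ge> 0 the monomial \<open>x\<^sub>1\<close> to the power k occurs with
    coefficient 1.\<close>
  from fun_cong[OF this, of "replicate_mset (nat k) 1"] show "k < 0"
    by (auto simp: complete_homogeneous_def series_zero_def split: if_splits)
qed (auto simp: complete_homogeneous_def series_zero_def)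

lemma complete_homogeneous_eq_one_iff: "complete_homogeneous k = series_one \<longleftrightarrow> k = 0"
proof
  assume "complete_homogeneous k = series_one"
  from fun_cong[OF this, of "{#}"] show "k = 0"
    by (simp add: complete_homogeneous_def series_one_def split: if_splits)
qed (auto simp: complete_homogeneous_def series_one_def)

lemma jacobi_trudi_entry_eq:
  "jacobi_trudi_entry lam mu i j = complete_homogeneous (beta lam i - beta mu j)"
  by (simp add: jacobi_trudi_entry_def beta_def algebra_simps)

text \<open>Here the 1-based rows meet the 0-based matrices. The shift raises all values of
  \<open>beta\<close> by 1 and leaves their differences unchanged.\<close>

lemma skew_rank_eq_zrank:
  assumes lam: "is_partition lam" and mu: "is_partition mu" and sub: "partition_contains lam mu"
    and n: "length lam \<le> n"
    and rows: "\<And>i. i \<in> {1..n} \<Longrightarrow> \<exists>j\<in>{1..n}. beta lam i < beta mu j \<Longrightarrow>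
      \<exists>j\<in>{1..n}. beta lam i = beta mu j"
  shows "skew_rank lam mu = int (zrank lam mu)"
proof -
  define l m where "l i = part lam (Suc i)" and "m i = part mu (Suc i)" for i
  define a b where "a i = int (l i) - int i" and "b i = int (m i) - int i" for i
  have ab: "beta lam (Suc i) = a i - 1" "beta mu (Suc i) = b i - 1" for i
    by (simp_all add: a_def b_def l_def m_def beta_def)
  have mono: "l j \<le> l i" "m j \<le> m i" if "i \<le> j" for i j
    using part_antimono[OF lam, of "Suc i" "Suc j"] part_antimono[OF mu, of "Suc i" "Suc j"] that
    by (simp_all add: l_def m_def)
  have le: "m i \<le> l i" for i
    using sub by (simp add: partition_contains_def l_def m_def)
  have "(i, j) \<in> skew_diagram lam mu \<longleftrightarrow> (i, j) \<in> shape n l m" for i j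
  proof (cases i)
    case 0
    then show ?thesis
      by (simp add: skew_diagram_def shape_def)
  next
    case (Suc k)
    then show ?thesis
      using n by (auto simp: skew_diagram_def l_def m_def part_def)
  qed
  then have shape: "skew_diagram lam mu = shape n l m"
    by auto
  have inj: "inj_on a {0..<n}" "inj_on b {0..<n}"
  proof -
    have "a j < a i" "b j < b i" if "i < j" for i j
      using mono[of i j] that by (simp_all add: a_def b_def)
    then show "inj_on a {0..<n}" "inj_on b {0..<n}"
      by (metis inj_onI less_irrefl linorder_neqE_nat)+
  qed
  have rows': "\<exists>j<n. a i = b j" if i: "i < n" and less: "\<exists>j<n. a i < b j" for i
  proof -
    obtain k where "k < n" "a i < b k"
      using less by blast
    then have "\<exists>j\<in>{1..n}. beta lam (Suc i) < beta mu j"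
      by (intro bexI[of _ "Suc k"]) (simp_all add: ab)
    then obtain j where "j \<in> {1..n}" "beta lam (Suc i) = beta mu j"
      using rows[of "Suc i"] i by auto
    then show ?thesis
      using ab[of i] ab[of "j - 1"] by (intro exI[of _ "j - 1"]) auto
  qed
  obtain q where q:
    "det (mat n n (\<lambda>(i, j). hpoly (a i - b j))) = [:0, 1:] ^ card {i\<in>{0..<n}. \<forall>j<n. a i \<noteq> b j} * q"
    "poly q 0 \<noteq> 0"
    by (rule det_hpoly_factor[OF inj rows'])
  have "schur_poly lam mu = det (mat n n (\<lambda>(i, j). hpoly (a i - b j)))"
  proof (rule schur_poly_eqI)
    fix t
    have "poly (det (mat n n (\<lambda>(i, j). hpoly (a i - b j)))) (of_nat t) =
        of_int (det (mat n n (\<lambda>(i, j). hones t (a i - b j))))"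
      by (simp only: poly_det poly_hpoly of_int_det)
    also have "det (mat n n (\<lambda>(i, j). hones t (a i - b j))) = int (card (tableaux (shape n l m) t))"
      unfolding a_def b_def using jacobi_trudi_at_ones[of n l m t] mono le by simp
    finally show "poly (det (mat n n (\<lambda>(i, j). hpoly (a i - b j)))) (of_nat t) =
        of_int (eval_ones (skew_schur lam mu) t)"
      by (simp only: eval_ones_skew_schur shape)
  qed
  then have "zrank lam mu = card {i\<in>{0..<n}. \<forall>j<n. a i \<noteq> b j}"
    using q by (intro zrank_eqI) (simp_all only:)
  also have "\<dots> = card {i\<in>{1..n}. \<forall>j\<in>{1..n}. beta lam i \<noteq> beta mu j}"
  proof -
    have S: "{1..n} = Suc ` {0..<n}"
      by (simp add: image_Suc_atLeastLessThan atLeastLessThanSuc_atLeastAtMost)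
    have "{i\<in>{1..n}. \<forall>j\<in>{1..n}. beta lam i \<noteq> beta mu j} = Suc ` {i\<in>{0..<n}. \<forall>j<n. a i \<noteq> b j}"
      unfolding S Compr_image_eq by (auto simp: ab simp del: image_Suc_atLeastLessThan)
    then show ?thesis
      by (simp add: card_image)
  qed
  finally show ?thesis
    using skew_rank_eq[OF lam mu sub n] by simp
qed

theorem theorem3p2:
  fixes lam mu :: "nat list"
  assumes "is_partition lam"
    and "is_partition mu"
    and "partition_contains lam mu"
  shows "(mu = [] \<longrightarrow> skew_rank lam mu = int (zrank lam mu)) \<and>
    (\<forall>n::nat. length lam \<le> n \<longrightarrow>
       (\<forall>i\<in>{1..n}.
          (\<exists>j\<in>{1..n}. jacobi_trudi_entry lam mu i j = series_zero) \<longrightarrow>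
          (\<exists>j\<in>{1..n}. jacobi_trudi_entry lam mu i j = series_one)) \<longrightarrow>
       skew_rank lam mu = int (zrank lam mu))"
proof (intro conjI impI allI)
  assume "mu = []"
  show "skew_rank lam mu = int (zrank lam mu)"
  proof (rule skew_rank_eq_zrank[OF assms order_refl])
    fix i assume i: "i \<in> {1..length lam}" and "\<exists>j\<in>{1..length lam}. beta lam i < beta mu j"
    moreover have mu_j: "beta mu j = - int j" for j
      using \<open>mu = []\<close> by (simp add: beta_def part_def)
    ultimately have "part lam i + 1 < i"
      by (auto simp: beta_def)
    \<comment> \<open>As \<open>beta mu j\<close> is -j, the entry 1 stands in column
      \<open>i - part lam i\<close>, which lies between 1 and i.\<close>
    then show "\<exists>j\<in>{1..length lam}. beta lam i = beta mu j"
      using i unfolding mu_j by (intro bexI[of _ "i - part lam i"]) (auto simp: beta_def)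
  qed
next
  fix n assume "length lam \<le> n" and
    "\<forall>i\<in>{1..n}. (\<exists>j\<in>{1..n}. jacobi_trudi_entry lam mu i j = series_zero) \<longrightarrow>
      (\<exists>j\<in>{1..n}. jacobi_trudi_entry lam mu i j = series_one)"
  then show "skew_rank lam mu = int (zrank lam mu)"
    using assms by (intro skew_rank_eq_zrank[of lam mu n])
      (simp_all add: jacobi_trudi_entry_eq complete_homogeneous_eq_zero_iff
        complete_homogeneous_eq_one_iff)
qed

end
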